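(* For any connected graphs $G_1$ and $G_2$, $$pd(G_1\times G_2)\le pd(G_1)+dim(G_2).$$
   Context: All graphs are finite, simple and connected; $d(u,v)$ is the shortest-path distance, and $d(v,P)=\min\{d(v,x):x\in P\}$ for a nonempty vertex set $P$. For an ordered set $S=\{v_1,\dots,v_k\}$ of vertices, $r(v|S)=(d(v,v_1),\dots,d(v,v_k))$; $S$ is a resolving set if $r(u|S)\neq r(v|S)$ for all distinct vertices $u,v$, and the metric dimension $dim(G)$ is the minimum cardinality of a resolving set. For an ordered partition $\Pi=\{P_1,\dots,P_t\}$ of the vertex set, $r(v|\Pi)=(d(v,P_1),\dots,d(v,P_t))$; $\Pi$ is a resolving partition if all these vectors are distinct, and the partition dimension $pd(G)$ is the minimum number of sets in a resolving partition. The Cartesian product $G_1\times G_2$ has vertex set $V_1\times V_2$, with $(a,b)\sim(c,d)$ iff ($a=c$ and $bd\in E_2$) or ($b=d$ and $ac\in E_1$). *)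

theory Defs
  imports "Graph_Theory.Graph_Theory" "HOL-Library.Disjoint_Sets"
begin

text \<open>
  A finite simple graph is a \<^locale>\<open>pair_graph\<close>: finite, loop-free, with a symmetric arc relation,
  so that an edge is represented by its two opposite arcs. The null graph is excluded by
  \<^const>\<open>Digraph_Component.connected\<close>.
\<close>

text \<open>
  The least element is meaningful only if \<open>v\<close> is reachable from \<open>u\<close>.
  The agreement with the weighted distance of the library, for unit weights, is shown below.
\<close>

definition graph_dist :: "'a pair_pre_digraph \<Rightarrow> 'a \<Rightarrow> 'a \<Rightarrow> nat" where
  "graph_dist G u v = (LEAST n. \<exists>p. pre_digraph.apath (with_proj G) u p v \<and> length p = n)"

definition graph_set_dist :: "'a pair_pre_digraph \<Rightarrow> 'a \<Rightarrow> 'a set \<Rightarrow> nat" where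
  "graph_set_dist G v P = Min (graph_dist G v ` P)"

text \<open>
  Ordered sets and ordered partitions are lists without repetitions. The empty list is admitted
  as an ordered set, so the one-vertex graph has metric dimension \<open>0\<close>.
\<close>

definition resolving_set :: "'a pair_pre_digraph \<Rightarrow> 'a list \<Rightarrow> bool" where
  "resolving_set G S \<longleftrightarrow> distinct S \<and> set S \<subseteq> pverts G \<and>
     inj_on (\<lambda>v. map (\<lambda>x. graph_dist G v x) S) (pverts G)"

definition metric_dimension :: "'a pair_pre_digraph \<Rightarrow> nat" where
  "metric_dimension G = (LEAST k. \<exists>S. resolving_set G S \<and> length S = k)"

definition resolving_partition :: "'a pair_pre_digraph \<Rightarrow> 'a set list \<Rightarrow> bool" where
  "resolving_partition G Ps \<longleftrightarrow> distinct Ps \<and> partition_on (pverts G) (set Ps) \<and>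
     inj_on (\<lambda>v. map (\<lambda>P. graph_set_dist G v P) Ps) (pverts G)"

definition partition_dimension :: "'a pair_pre_digraph \<Rightarrow> nat" where
  "partition_dimension G = (LEAST t. \<exists>Ps. resolving_partition G Ps \<and> length Ps = t)"

definition cartesian_product ::
  "'a pair_pre_digraph \<Rightarrow> 'b pair_pre_digraph \<Rightarrow> ('a \<times> 'b) pair_pre_digraph" where
  "cartesian_product G H = \<lparr>
     pverts = pverts G \<times> pverts H,
     parcs = {((a, b), (c, d)) | a b c d.
       (a \<in> pverts G \<and> a = c \<and> (b, d) \<in> parcs H) \<or>
       (b \<in> pverts H \<and> b = d \<and> (a, c) \<in> parcs G)} \<rparr>"

lemma (in pair_wf_digraph) mu_unit_eq_graph_dist:
  assumes "u \<rightarrow>\<^sup>*\<^bsub>with_proj G\<^esub> v"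
  shows "\<mu> (\<lambda>_. 1) u v = ereal (real (graph_dist G u v))"
proof -
  have cost: "awalk_cost (\<lambda>_. 1) p = real (length p)" for p :: "('a \<times> 'a) list"
    by (induction p) auto
  from assms obtain q where "apath u q v" by (auto simp: reachable_apath)
  then have "\<exists>n p. apath u p v \<and> length p = n" by blast
  then have "\<exists>p. apath u p v \<and> length p = graph_dist G u v"
    unfolding graph_dist_def by (rule LeastI_ex)
  then obtain p where p: "apath u p v" "length p = graph_dist G u v" by blast
  have le: "graph_dist G u v \<le> length q" if "awalk u q v" for q
  proof -
    have "apath u (awalk_to_apath q) v" using that by (rule apath_awalk_to_apath)
    then have "graph_dist G u v \<le> length (awalk_to_apath q)"
      unfolding graph_dist_def by (intro Least_le) blast
    also have "\<dots> \<le> length q"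
      using that
    proof (induction rule: awalk_to_apath_induct)
      case (path p)
      then have "awalk_to_apath p = p" by (auto simp: awalk_to_apath.simps)
      then show ?case by simp
    next
      case (decomp p q r s)
      then have "p = q @ r @ s" using awalk_cyc_decomp_has_prop[of u p v] by auto
      with decomp show ?case using step_awalk_to_apath[of _ p _ q r s] by auto
    qed
    finally show ?thesis .
  qed
  show ?thesis
    unfolding \<mu>_def
  proof (rule INF_eqI)
    show "ereal (real (graph_dist G u v)) \<le> ereal (awalk_cost (\<lambda>_. 1) q)"
      if "q \<in> {p. awalk u p v}" for q
      using that le by (simp add: cost)
    show "y \<le> ereal (real (graph_dist G u v))"
      if "\<And>q. q \<in> {p. awalk u p v} \<Longrightarrow> y \<le> ereal (awalk_cost (\<lambda>_. 1) q)" for y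
      using that[of p] p by (auto simp: cost apath_def)
  qed
qed

lemma pair_graph_cartesian_product:
  assumes "pair_graph G" "pair_graph H"
  shows "pair_graph (cartesian_product G H)"
proof -
  interpret G: pair_graph G by fact
  interpret H: pair_graph H by fact
  let ?P = "cartesian_product G H"
  have sub: "parcs ?P \<subseteq> (pverts G \<times> pverts H) \<times> (pverts G \<times> pverts H)"
    by (auto simp: cartesian_product_def dest: G.in_arcsD1 G.in_arcsD2 H.in_arcsD1 H.in_arcsD2)
  have V: "pverts ?P = pverts G \<times> pverts H" by (simp add: cartesian_product_def)
  have "sym (parcs G)" "sym (parcs H)"
    using G.pair_sym_arcs H.pair_sym_arcs by (simp_all add: symmetric_def)
  then have "sym (parcs ?P)"
    by (auto simp: cartesian_product_def sym_def)
  moreover have "finite (parcs ?P)"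
    using sub by (rule finite_subset) (simp add: G.pair_finite_verts H.pair_finite_verts)
  moreover have "fst e \<noteq> snd e" if "e \<in> parcs ?P" for e
    using that by (auto simp: cartesian_product_def dest: G.pair_no_loops H.pair_no_loops)
  ultimately show ?thesis
    using sub V by unfold_locales (auto simp: symmetric_def G.pair_finite_verts H.pair_finite_verts)
qed

end

theory Submission
  imports Defs
begin

text \<open>
  Let \<open>A, A\<^sub>2, \<dots>, A\<^sub>t\<close> be a resolving partition of \<open>G\<^sub>1\<close> and \<open>S\<close> a resolving set of \<open>G\<^sub>2\<close>. The sets
  \<open>A\<^sub>i \<times> V\<^sub>2\<close> for \<open>i \<ge> 2\<close>, \<open>A \<times> {s}\<close> for \<open>s \<in> S\<close>, and \<open>A \<times> (V\<^sub>2 - S)\<close> if nonempty, form a resolving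
  partition of the product. Distances in the product are sums of distances in the factors, so if
  \<open>(a, b)\<close> and \<open>(a', b')\<close> have equal codes, then \<open>d(a, A\<^sub>i) = d(a', A\<^sub>i)\<close> for \<open>i \<ge> 2\<close>, and the
  distances of \<open>b'\<close> to all members of \<open>S\<close> and to \<open>V\<^sub>2 - S\<close> exceed those of \<open>b\<close> by the same constant
  \<open>c = d(a, A) - d(a', A)\<close>. One of these distances vanishes at \<open>b'\<close>, and one vanishes at \<open>b\<close>, so
  \<open>c = 0\<close>; hence \<open>a = a'\<close> and \<open>b = b'\<close>.
\<close>

section \<open>Distances through relational powers of the arc relation\<close>

lemma (in pair_wf_digraph) awalk_length_iff_relpow:
  "(\<exists>p. awalk u p v \<and> length p = n) \<longleftrightarrow> u \<in> pverts G \<and> (u, v) \<in> parcs G ^^ n"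
proof (induction n arbitrary: u)
  case 0
  \<comment> \<open>\<open>parcs G ^^ 0\<close> is the identity on the whole type, so the empty walk
    needs the separate condition \<open>u \<in> pverts G\<close>.\<close>
  then show ?case by (auto simp: awalk_Nil_iff)
next
  case (Suc n)
  have "(\<exists>p. awalk u p v \<and> length p = Suc n) \<longleftrightarrow>
      (\<exists>w. (u, w) \<in> parcs G \<and> (\<exists>p. awalk w p v \<and> length p = n))"
  proof (safe)
    fix p assume "awalk u p v" "length p = Suc n"
    then show "\<exists>w. (u, w) \<in> parcs G \<and> (\<exists>p. awalk w p v \<and> length p = n)"
      by (cases p) (force simp: awalk_Cons_iff)+
  next
    fix w p assume "(u, w) \<in> parcs G" "awalk w p v" "n = length p"
    then have "awalk u ((u, w) # p) v \<and> length ((u, w) # p) = Suc (length p)"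
      by (simp add: awalk_Cons_iff)
    then show "\<exists>q. awalk u q v \<and> length q = Suc (length p)" by blast
  qed
  also have "\<dots> \<longleftrightarrow> u \<in> pverts G \<and> (u, v) \<in> parcs G ^^ Suc n"
    unfolding Suc.IH by (auto simp: relpow_commute[symmetric] dest: in_arcsD1 in_arcsD2)
  finally show ?case .
qed

text \<open>\<open>graph_dist\<close> minimises over paths, whereas a relational power yields a walk
  that may repeat vertices. The unit-cost distance \<open>\<mu>\<close>, an infimum over all walks,
  mediates between the two.\<close>

lemma (in pair_wf_digraph) graph_dist_le:
  assumes "u \<in> pverts G" "(u, v) \<in> parcs G ^^ n"
  shows "graph_dist G u v \<le> n"
proof -
  obtain p where p: "awalk u p v" "length p = n"
    using assms awalk_length_iff_relpow by blast
  have cost: "awalk_cost (\<lambda>_. 1) q = real (length q)" for q :: "('a \<times> 'a) list"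
    by (induction q) auto
  show ?thesis
    using min_cost_le_walk_cost[OF p(1), of "\<lambda>_. 1"] mu_unit_eq_graph_dist[of u v] p
    by (simp add: cost reachable_awalkI)
qed

lemma (in pair_wf_digraph) graph_dist_relpow:
  assumes "u \<rightarrow>\<^sup>*\<^bsub>with_proj G\<^esub> v"
  shows "(u, v) \<in> parcs G ^^ graph_dist G u v"
proof -
  have "\<exists>n p. apath u p v \<and> length p = n"
    using assms by (auto simp: reachable_apath)
  then have "\<exists>p. apath u p v \<and> length p = graph_dist G u v"
    unfolding graph_dist_def by (rule LeastI_ex)
  then show ?thesis
    using awalk_length_iff_relpow awalkI_apath by blast
qed

section \<open>Connected graphs: zero distances and attained dimensions\<close>

locale connected_pair_graph = pair_graph +
  assumes connected: "Digraph_Component.connected (with_proj G)"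
begin

lemma verts_nonempty: "pverts G \<noteq> {}"
  using connected by (auto simp: connected_def strongly_connected_def)

text \<open>Connectedness of a digraph refers to its symmetric closure; as the arcs are already
  symmetric, any two vertices are joined by a walk.\<close>

lemma graph_dist_walk:
  assumes "u \<in> pverts G" "v \<in> pverts G"
  shows "(u, v) \<in> parcs G ^^ graph_dist G u v"
  using assms graph_dist_relpow connected symmetric_connected_imp_strongly_connected sym_arcs
  by (auto simp: strongly_connected_def)

lemma graph_dist_eq_0_iff:
  assumes "u \<in> pverts G" "v \<in> pverts G"
  shows "graph_dist G u v = 0 \<longleftrightarrow> u = v"
  using graph_dist_walk[OF assms] graph_dist_le[of u v 0] assms by auto

lemma graph_set_dist_eq_0_iff:
  assumes "u \<in> pverts G" "P \<subseteq> pverts G" "P \<noteq> {}"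
  shows "graph_set_dist G u P = 0 \<longleftrightarrow> u \<in> P"
proof -
  have fin: "finite P" using assms finite_subset pair_finite_verts by blast
  then have "graph_set_dist G u P = 0 \<longleftrightarrow> 0 \<in> graph_dist G u ` P"
    unfolding graph_set_dist_def using assms
    by (metis Min_eq_iff finite_imageI image_is_empty le0)
  also have "\<dots> \<longleftrightarrow> u \<in> P"
    using assms graph_dist_eq_0_iff by (force simp: image_iff)
  finally show ?thesis .
qed

text \<open>The list of all vertices resolves, because the coordinate at \<open>x\<close> vanishes
  only at \<open>x\<close>; hence the minimum is attained.\<close>

lemma ex_metric_dimension:
  obtains S where "resolving_set G S" "length S = metric_dimension G"
proof -
  obtain S where S: "set S = pverts G" "distinct S"
    using finite_distinct_list pair_finite_verts by blast
  have "resolving_set G S"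
    unfolding resolving_set_def inj_on_def using S graph_dist_eq_0_iff by (auto; metis)
  then have "\<exists>k S. resolving_set G S \<and> length S = k" by blast
  from LeastI_ex[OF this] show ?thesis
    using that unfolding metric_dimension_def by blast
qed

text \<open>Singletons form a resolving partition, again because the coordinate at
  \<open>{x}\<close> vanishes only at \<open>x\<close>.\<close>

lemma ex_partition_dimension:
  obtains Ps where "resolving_partition G Ps" "length Ps = partition_dimension G"
proof -
  obtain S where S: "set S = pverts G" "distinct S"
    using finite_distinct_list pair_finite_verts by blast
  let ?Ps = "map (\<lambda>x. {x}) S"
  have "x = y" if "x \<in> pverts G" "y \<in> pverts G"
    "map (graph_set_dist G x) ?Ps = map (graph_set_dist G y) ?Ps" for x y
  proof -
    have "graph_set_dist G x {x} = 0"
      using that graph_set_dist_eq_0_iff by blast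
    moreover have "graph_set_dist G x {x} = graph_set_dist G y {x}"
      using that S by auto
    ultimately have "y \<in> {x}"
      using that graph_set_dist_eq_0_iff[of y "{x}"] by simp
    then show ?thesis by simp
  qed
  then have "resolving_partition G ?Ps"
    unfolding resolving_partition_def inj_on_def
    using S partition_on_singletons[of "pverts G"] by (auto simp: distinct_map inj_on_def)
  then have "\<exists>k Ps. resolving_partition G Ps \<and> length Ps = k" by blast
  from LeastI_ex[OF this] show ?thesis
    using that unfolding partition_dimension_def by blast
qed

end

section \<open>Walks in the product\<close>

lemma pverts_cartesian_product [simp]:
  "pverts (cartesian_product G H) = pverts G \<times> pverts H"
  by (simp add: cartesian_product_def)

text \<open>Each arc of the product follows an arc of one factor and fixes the other coordinate;
  \<open>i\<close> and \<open>j\<close> count the arcs of either kind.\<close>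

lemma relpow_cartesian_productD:
  assumes "((a, b), (c, d)) \<in> parcs (cartesian_product G H) ^^ n"
  shows "\<exists>i j. n = i + j \<and> (a, c) \<in> parcs G ^^ i \<and> (b, d) \<in> parcs H ^^ j"
  using assms
proof (induction n arbitrary: c d)
  case 0
  then show ?case by auto
next
  case (Suc n)
  then obtain c' d' where walk: "((a, b), (c', d')) \<in> parcs (cartesian_product G H) ^^ n"
    and arc: "((c', d'), (c, d)) \<in> parcs (cartesian_product G H)"
    by auto
  obtain i j where ij: "n = i + j" "(a, c') \<in> parcs G ^^ i" "(b, d') \<in> parcs H ^^ j"
    using Suc.IH[OF walk] by blast
  consider "c' = c" "(d', d) \<in> parcs H" | "d' = d" "(c', c) \<in> parcs G"
    using arc by (auto simp: cartesian_product_def)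
  then show ?case
  proof cases
    case 1
    then have "Suc n = i + Suc j" "(a, c) \<in> parcs G ^^ i" "(b, d) \<in> parcs H ^^ Suc j"
      using ij by auto
    then show ?thesis by blast
  next
    case 2
    then have "Suc n = Suc i + j" "(a, c) \<in> parcs G ^^ Suc i" "(b, d) \<in> parcs H ^^ j"
      using ij by auto
    then show ?thesis by blast
  qed
qed

lemma relpow_cartesian_product_left:
  assumes "(a, c) \<in> parcs G ^^ n" "b \<in> pverts H"
  shows "((a, b), (c, b)) \<in> parcs (cartesian_product G H) ^^ n"
  using assms by (induction n arbitrary: c) (auto simp: cartesian_product_def intro!: relcompI)

lemma relpow_cartesian_product_right:
  assumes "(b, d) \<in> parcs H ^^ n" "a \<in> pverts G"
  shows "((a, b), (a, d)) \<in> parcs (cartesian_product G H) ^^ n"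
  using assms by (induction n arbitrary: d) (auto simp: cartesian_product_def intro!: relcompI)

lemma Min_sum_Times:
  fixes f :: "'a \<Rightarrow> nat" and g :: "'b \<Rightarrow> nat"
  assumes "finite A" "finite B" "A \<noteq> {}" "B \<noteq> {}"
  shows "Min ((\<lambda>(x, y). f x + g y) ` (A \<times> B)) = Min (f ` A) + Min (g ` B)"
proof (rule Min_eqI)
  show "finite ((\<lambda>(x, y). f x + g y) ` (A \<times> B))" using assms by simp
  show "Min (f ` A) + Min (g ` B) \<le> z" if "z \<in> (\<lambda>(x, y). f x + g y) ` (A \<times> B)" for z
    using that assms by (auto intro!: add_mono)
  have "Min (f ` A) \<in> f ` A" "Min (g ` B) \<in> g ` B" using assms by simp_all
  then obtain x y where "x \<in> A" "y \<in> B" "Min (f ` A) = f x" "Min (g ` B) = g y" by blast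
  then show "Min (f ` A) + Min (g ` B) \<in> (\<lambda>(x, y). f x + g y) ` (A \<times> B)" by force
qed

section \<open>Distances and a resolving partition in the product\<close>

locale two_connected_pair_graphs =
  G: connected_pair_graph G + H: connected_pair_graph H
  for G :: "'a pair_pre_digraph" and H :: "'b pair_pre_digraph"
begin

text \<open>Upper bound: walk from \<open>(a, b)\<close> to \<open>(c, b)\<close> and on to
  \<open>(c, d)\<close>. Lower bound: project a shortest walk to both factors.\<close>

lemma graph_dist_cartesian_product:
  assumes "a \<in> pverts G" "c \<in> pverts G" "b \<in> pverts H" "d \<in> pverts H"
  shows "graph_dist (cartesian_product G H) (a, b) (c, d) = graph_dist G a c + graph_dist H b d"
proof -
  interpret P: pair_graph "cartesian_product G H"
    using pair_graph_cartesian_product[OF G.pair_graph H.pair_graph] .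
  have walk: "((a, b), (c, d)) \<in>
      parcs (cartesian_product G H) ^^ (graph_dist G a c + graph_dist H b d)"
    unfolding relpow_add
    using relpow_cartesian_product_left[OF G.graph_dist_walk, of a c b]
      relpow_cartesian_product_right[OF H.graph_dist_walk, of b d c] assms by blast
  \<comment> \<open>The distance is known to be realised by a walk only between reachable vertices;
    the walk just built provides reachability.\<close>
  have "(a, b) \<rightarrow>\<^sup>*\<^bsub>with_proj (cartesian_product G H)\<^esub> (c, d)"
  proof -
    have "(a, b) \<in> pverts (cartesian_product G H)" using assms by simp
    then obtain p where "P.awalk (a, b) p (c, d)"
      using walk P.awalk_length_iff_relpow by blast
    then show ?thesis by (rule P.reachable_awalkI)
  qed
  from relpow_cartesian_productD[OF P.graph_dist_relpow[OF this]]
  obtain i j where ij: "graph_dist (cartesian_product G H) (a, b) (c, d) = i + j"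
    and "(a, c) \<in> parcs G ^^ i" "(b, d) \<in> parcs H ^^ j"
    by blast
  then have "graph_dist G a c \<le> i" "graph_dist H b d \<le> j"
    using G.graph_dist_le H.graph_dist_le assms by blast+
  then have "graph_dist G a c + graph_dist H b d \<le> graph_dist (cartesian_product G H) (a, b) (c, d)"
    unfolding ij by (rule add_mono)
  moreover have "graph_dist (cartesian_product G H) (a, b) (c, d) \<le>
      graph_dist G a c + graph_dist H b d"
    using P.graph_dist_le[OF _ walk] assms by simp
  ultimately show ?thesis by simp
qed

lemma graph_set_dist_Times:
  assumes "a \<in> pverts G" "b \<in> pverts H"
    and "A \<subseteq> pverts G" "A \<noteq> {}" "B \<subseteq> pverts H" "B \<noteq> {}"
  shows "graph_set_dist (cartesian_product G H) (a, b) (A \<times> B)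
    = graph_set_dist G a A + graph_set_dist H b B"
proof -
  have "finite A" "finite B"
    using assms finite_subset G.pair_finite_verts H.pair_finite_verts by blast+
  have "graph_dist (cartesian_product G H) (a, b) ` (A \<times> B)
      = (\<lambda>(x, y). graph_dist G a x + graph_dist H b y) ` (A \<times> B)"
    using assms by (intro image_cong) (auto simp: graph_dist_cartesian_product subset_iff)
  then show ?thesis
    unfolding graph_set_dist_def
    using Min_sum_Times \<open>finite A\<close> \<open>finite B\<close> assms by metis
qed

text \<open>The conditional keeps the empty set out of the partition when \<open>S\<close> contains
  every vertex of \<open>H\<close>.\<close>

lemma resolving_partition_cartesian_product:
  assumes "resolving_partition G (A # As)" "resolving_set H S"
  shows "resolving_partition (cartesian_product G H)
    (map (\<lambda>P. P \<times> pverts H) As @ map (\<lambda>x. A \<times> {x}) S @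
      (if pverts H \<subseteq> set S then [] else [A \<times> (pverts H - set S)]))"
    (is "resolving_partition ?P ?Ps")
proof -
  let ?R = "pverts H - set S"
  have part: "partition_on (pverts G) (insert A (set As))"
    and dist: "distinct As" "A \<notin> set As"
    and inj: "inj_on (\<lambda>v. map (graph_set_dist G v) (A # As)) (pverts G)"
    using assms by (auto simp: resolving_partition_def)
  have S: "distinct S" "set S \<subseteq> pverts H"
    and injS: "inj_on (\<lambda>v. map (graph_dist H v) S) (pverts H)"
    using assms by (auto simp: resolving_set_def)
  have A: "A \<noteq> {}" "A \<subseteq> pverts G" and As: "\<And>P. P \<in> set As \<Longrightarrow> P \<noteq> {} \<and> P \<subseteq> pverts G"
    and Un: "A \<union> \<Union>(set As) = pverts G"
    using part by (auto simp: partition_on_def)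
  have disjA: "A \<inter> P = {}" if "P \<in> set As" for P
    using part that dist by (auto simp: partition_on_def disjoint_def)
  have disjAs: "P \<inter> Q = {}" if "P \<in> set As" "Q \<in> set As" "P \<noteq> Q" for P Q
    using part that by (auto simp: partition_on_def disjoint_def)
  have set_Ps: "set ?Ps = (\<lambda>P. P \<times> pverts H) ` set As \<union> (\<lambda>x. A \<times> {x}) ` set S \<union>
      (if ?R = {} then {} else {A \<times> ?R})"
    by auto
  have "distinct ?Ps"
    \<comment> \<open>Nonempty factors are determined by their product, and disjointness from
      \<open>A\<close> separates the blocks coming from \<open>As\<close> from the others.\<close>
    using dist S A As disjA H.verts_nonempty
    by (auto simp: distinct_map inj_on_def times_eq_iff)
  moreover have "partition_on (pverts ?P) (set ?Ps)"
  proof (rule partition_onI)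
    show "\<Union>(set ?Ps) = pverts ?P"
      unfolding set_Ps using Un S by auto
    show "{} \<notin> set ?Ps"
    proof
      assume "{} \<in> set ?Ps"
      then have "(\<exists>P\<in>set As. P \<times> pverts H = {}) \<or> A = {}"
        unfolding set_Ps by (auto split: if_splits)
      then show False using A As H.verts_nonempty by simp
    qed
    show "disjnt p q" if "p \<in> set ?Ps" "q \<in> set ?Ps" "p \<noteq> q" for p q
    proof -
      have cases: "(\<exists>P\<in>set As. r = P \<times> pverts H) \<or> (\<exists>x\<in>set S. r = A \<times> {x}) \<or> r = A \<times> ?R"
        if "r \<in> set ?Ps" for r
        using that unfolding set_Ps by (auto split: if_splits)
      \<comment> \<open>Distinct blocks have disjoint first factors or disjoint second
        factors.\<close>
      show ?thesis
        using cases[OF that(1)] cases[OF that(2)] that(3) disjA disjAs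
        by (elim disjE bexE) (force simp: disjnt_def Times_Int_Times)+
    qed
  qed
  moreover have "inj_on (\<lambda>v. map (graph_set_dist ?P v) ?Ps) (pverts ?P)"
  proof (rule inj_onI)
    fix v v'
    assume "v \<in> pverts ?P" "v' \<in> pverts ?P"
      and code: "map (graph_set_dist ?P v) ?Ps = map (graph_set_dist ?P v') ?Ps"
    then obtain a b a' b' where v: "v = (a, b)" "v' = (a', b')"
      and V: "a \<in> pverts G" "b \<in> pverts H" "a' \<in> pverts G" "b' \<in> pverts H"
      by auto
    have eq: "graph_set_dist ?P (a, b) Q = graph_set_dist ?P (a', b') Q" if "Q \<in> set ?Ps" for Q
      using code that unfolding v map_eq_conv by blast
    \<comment> \<open>Both \<open>b\<close> and \<open>b'\<close> have distance 0 to
      \<open>pverts H\<close>, so only the first summand remains.\<close>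
    have eqAs: "graph_set_dist G a P = graph_set_dist G a' P" if "P \<in> set As" for P
      using eq[of "P \<times> pverts H"] that V As H.verts_nonempty
        H.graph_set_dist_eq_0_iff[of _ "pverts H"]
      by (simp add: graph_set_dist_Times)
    \<comment> \<open>These are the second factors of the blocks inside
      \<open>A \<times> pverts H\<close>; together they cover \<open>pverts H\<close>.\<close>
    define Bs where "Bs = (\<lambda>x. {x}) ` set S \<union> (if ?R = {} then {} else {?R})"
    have Bs: "B \<subseteq> pverts H" "B \<noteq> {}" if "B \<in> Bs" for B
      using that S by (auto simp: Bs_def split: if_splits)
    have sum_eq: "graph_set_dist G a A + graph_set_dist H b B
        = graph_set_dist G a' A + graph_set_dist H b' B" if "B \<in> Bs" for B
    proof -
      have "A \<times> B \<in> set ?Ps" using that unfolding set_Ps Bs_def by (auto split: if_splits)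
      then show ?thesis using eq[of "A \<times> B"] V A Bs[OF that] by (simp add: graph_set_dist_Times)
    qed
    have zero: "\<exists>B\<in>Bs. graph_set_dist H y B = 0" if "y \<in> pverts H" for y
    proof -
      have "\<exists>B\<in>Bs. y \<in> B" using that by (auto simp: Bs_def)
      then show ?thesis using H.graph_set_dist_eq_0_iff Bs that by metis
    qed
    \<comment> \<open>A set in \<open>Bs\<close> containing \<open>b'\<close> gives
      \<open>graph_set_dist G a A \<le> graph_set_dist G a' A\<close>; one containing
      \<open>b\<close> gives the converse.\<close>
    have eqA: "graph_set_dist G a A = graph_set_dist G a' A"
      using zero[OF V(2)] zero[OF V(4)] sum_eq by (metis add.right_neutral le_add1 le_antisym)
    then have "a = a'"
      using inj V eqAs by (auto simp: inj_on_def)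
    \<comment> \<open>Cancelling the equal first summands at the singletons in \<open>Bs\<close>
      leaves the code with respect to \<open>S\<close>.\<close>
    moreover have "graph_dist H b x = graph_dist H b' x" if "x \<in> set S" for x
      using sum_eq[of "{x}"] eqA that by (auto simp: Bs_def graph_set_dist_def)
    then have "b = b'"
      using injS V by (auto simp: inj_on_def)
    ultimately show "v = v'" by (simp add: v)
  qed
  ultimately show ?thesis by (simp only: resolving_partition_def)
qed

end

theorem theorem2:
  fixes G\<^sub>1 :: "'a pair_pre_digraph" and G\<^sub>2 :: "'b pair_pre_digraph"
  assumes "pair_graph G\<^sub>1" and "Digraph_Component.connected (with_proj G\<^sub>1)"
    and "pair_graph G\<^sub>2" and "Digraph_Component.connected (with_proj G\<^sub>2)"
  shows "partition_dimension (cartesian_product G\<^sub>1 G\<^sub>2)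
    \<le> partition_dimension G\<^sub>1 + metric_dimension G\<^sub>2"
proof -
  interpret two_connected_pair_graphs G\<^sub>1 G\<^sub>2
    using assms
    by (simp add: two_connected_pair_graphs_def connected_pair_graph_def
        connected_pair_graph_axioms_def)
  obtain Ps where Ps: "resolving_partition G\<^sub>1 Ps" "length Ps = partition_dimension G\<^sub>1"
    by (rule G.ex_partition_dimension)
  obtain S where S: "resolving_set G\<^sub>2 S" "length S = metric_dimension G\<^sub>2"
    by (rule H.ex_metric_dimension)
  \<comment> \<open>A block to split exists because \<open>G\<^sub>1\<close> has a vertex.\<close>
  have "Ps \<noteq> []"
    using Ps(1) G.verts_nonempty by (auto simp: resolving_partition_def partition_on_def)
  then obtain A As where AAs: "Ps = A # As" by (cases Ps) auto
  let ?Qs = "map (\<lambda>P. P \<times> pverts G\<^sub>2) As @ map (\<lambda>x. A \<times> {x}) S @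
      (if pverts G\<^sub>2 \<subseteq> set S then [] else [A \<times> (pverts G\<^sub>2 - set S)])"
  have "partition_dimension (cartesian_product G\<^sub>1 G\<^sub>2) \<le> length ?Qs"
    unfolding partition_dimension_def
    using resolving_partition_cartesian_product Ps(1) S(1) AAs by (blast intro: Least_le)
  \<comment> \<open>Splitting \<open>A\<close> frees its own place, which pays for the remainder
    block if there is one.\<close>
  also have "\<dots> \<le> partition_dimension G\<^sub>1 + metric_dimension G\<^sub>2"
    using Ps(2) S(2) AAs by simp
  finally show ?thesis .
qed

end
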